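(* Let $p,q\in(0,1]$ and assume the following. (a) For every $i$, $h_i:\Theta\to\mathbb{R}$ satisfies $|h_i(t_1)-h_i(t_2)|\le\overline h_i|t_1-t_2|^p$ for all $t_1,t_2\in\Theta$; the function $t\mapsto\widetilde M_i(t,X_i)$ is, with probability $1$, continuously differentiable on $\Theta$ and satisfies $|\widetilde M_i'(t,X_i)-\widetilde M_i'(\theta,X_i)|\le\overline{M_i'}\,|t-\theta|^q$ for all $t\in\Theta$, where $\mathbf{E}\overline{M_i'}<\infty$; moreover $\mathbf{E}\widetilde M_i(\theta,X_i)=0$, $\mathbf{E}\widetilde M_i^2(\theta,X_i)<\infty$, $\mathbf{E}|\widetilde M_i'(\theta,X_i)|<\infty$. (b) For all sufficiently large $n$, $I_n=\sum_{i=1}^nh_i^2(\theta)\mathbf{E}\widetilde M_i^2(\theta,X_i)>0$ and $J_n=\sum_{i=1}^nh_i(\theta)\mathbf{E}\widetilde M_i'(\theta,X_i)\ne0$, and $\sum_{i=1}^nh_i(\theta)\widetilde M_i(\theta,X_i)/\sqrt{I_n}\Rightarrow\mathcal{N}(0,1)$. (c) There are a consistent estimator $\theta_n^*$ of $\theta$ and a statistic $J_n^*$ such that $J_n^*/J_n\xrightarrow{p}1$ and $$|\theta_n^*-\theta|^{1+p}\sum_{i=1}^n\overline h_i\,\mathbf{E}|\widetilde M_i'(\theta,X_i)|\big/\sqrt{I_n}\xrightarrow{p}0,$$ $$|\theta_n^*-\theta|^{1+q}\sum_{i=1}^n\big(|\theta_n^*-\theta|^p\,\overline h_i+|h_i(\theta)|\big)\mathbf{E}\overline{M_i'}\big/\sqrt{I_n}\xrightarrow{p}0,$$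 $$(\theta_n^*-\theta)(J_n^*-J_n)/\sqrt{I_n}\xrightarrow{p}0,\qquad(\theta_n^*-\theta)\Big(\sum_{i=1}^nh_i(\theta)\widetilde M_i'(\theta,X_i)-J_n\Big)\big/\sqrt{I_n}\xrightarrow{p}0.$$ (d) $\sum_{i=1}^n\big(h_i(\theta_n^* )-h_i(\theta)\big)\widetilde M_i(\theta,X_i)\big/\sqrt{I_n}\xrightarrow{p}0$. Then the one-step $M$-estimator $$\theta_{n,J}^{**}=\theta_n^*-\sum_{i=1}^nh_i(\theta_n^* )\widetilde M_i(\theta_n^*,X_i)\big/J_n^*$$ is defined with probability tending to $1$ and $$\frac{J_n}{\sqrt{I_n}}\big(\theta_{n,J}^{**}-\theta\big)\Rightarrow\mathcal{N}(0,1).$$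
   Context: All limits are as $n\to\infty$; $\xrightarrow{p}$ is convergence in probability, $\Rightarrow$ is weak convergence of distributions. Setting: for each $n$ one observes independent elements $X_1,\dots,X_n$ of an arbitrary measurable space, not necessarily identically distributed. Their distributions depend on an unknown parameter belonging to an open set $\Theta\subset\mathbb{R}$, may also depend on $n$, and may depend on nuisance parameters. The symbol $\theta\in\Theta$ denotes the (fixed) true value, and $\mathbf{P},\mathbf{E}$ refer to the true distributions. For each $i$ there are given non-random functions $h_i(t)$ and functions $\widetilde M_i(t,X_i)$ of $t\in\Theta$; the prime denotes the derivative in the first argument. The $\overline h_i\ge0$ are constants, and the $\overline{M_i'}\ge0$ are random variables (depending on $X_i$). Consistency means $\theta_n^*\xrightarrow{p}\theta$. A statistic is "defined with probability tending to $1$" if the probability that all quantities in its definition are defined (arguments in $\Theta$, denominator nonzero) tends to $1$. *)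

theory Defs
  imports "HOL-Probability.Probability"
begin

text \<open>
  The probability space may change with \<open>n\<close>. Measurability is part of the definition because
  \<^const>\<open>measure\<close> is \<open>0\<close> on non-measurable sets.
\<close>

definition tendsto_in_probability ::
    "(nat \<Rightarrow> 'w measure) \<Rightarrow> (nat \<Rightarrow> 'w \<Rightarrow> real) \<Rightarrow> real \<Rightarrow> bool" where
  "tendsto_in_probability P Y c \<longleftrightarrow>
     (\<forall>n. Y n \<in> borel_measurable (P n)) \<and>
     (\<forall>\<epsilon>>0. (\<lambda>n. measure (P n) {\<omega> \<in> space (P n). \<epsilon> < \<bar>Y n \<omega> - c\<bar>}) \<longlonglongrightarrow> 0)"

definition is_statistic ::
    "'w measure \<Rightarrow> 'x measure \<Rightarrow> nat \<Rightarrow> (nat \<Rightarrow> 'w \<Rightarrow> 'x) \<Rightarrow> ('w \<Rightarrow> real) \<Rightarrow> bool" where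
  "is_statistic P S n X T \<longleftrightarrow>
     (\<exists>g \<in> borel_measurable (\<Pi>\<^sub>M i\<in>{1..n}. S).
        \<forall>\<omega>\<in>space P. T \<omega> = g (\<lambda>i\<in>{1..n}. X i \<omega>))"

abbreviation param_deriv :: "(real \<Rightarrow> 'x \<Rightarrow> real) \<Rightarrow> real \<Rightarrow> 'x \<Rightarrow> real" where
  "param_deriv M t x \<equiv> deriv (\<lambda>s. M s x) t"

text \<open>
  The functions \<open>h i\<close> and \<open>\<lambda>t. M i t x\<close> are only meaningful on \<open>\<Theta>\<close>. The estimator is therefore
  defined only if the preliminary value \<open>t\<close> lies in \<open>\<Theta>\<close> and the denominator \<open>j\<close> is nonzero;
  otherwise it is an unspecified constant, not the value given by the totality of HOL functions.

  If \<open>t \<mapsto> M i t (X i)\<close> is regular only almost surely, plugging a random \<open>t\<close> into this expression is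
  measurable only up to a null set, so its law has to be taken under the \<^const>\<open>completion\<close> of
  the probability measure.
\<close>

definition one_step_defined :: "real set \<Rightarrow> real \<Rightarrow> real \<Rightarrow> bool" where
  "one_step_defined \<Theta> t j \<longleftrightarrow> t \<in> \<Theta> \<and> j \<noteq> 0"

definition one_step_estimate ::
    "real set \<Rightarrow> nat \<Rightarrow> (nat \<Rightarrow> real \<Rightarrow> real) \<Rightarrow> (nat \<Rightarrow> real \<Rightarrow> 'x \<Rightarrow> real) \<Rightarrow>
     (nat \<Rightarrow> 'x) \<Rightarrow> real \<Rightarrow> real \<Rightarrow> real" where
  "one_step_estimate \<Theta> n h M x t j =
     (if one_step_defined \<Theta> t j then t - (\<Sum>i=1..n. h i t * M i t (x i)) / j else undefined)"

end

theory Submission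
  imports Defs
begin

text \<open>
  Write \<open>D = \<theta>s - \<theta>\<close>. Expanding \<open>h\<close> and \<open>M\<close> around \<open>\<theta>\<close> turns the normalised error into
  \<open>J / Js * (- score - remainder)\<close>, where the score is the sum in the central limit hypothesis and the
  remainder consists of the term in \<open>d\<close>, those in \<open>c3\<close> and \<open>c4\<close>, and sums of powers of \<open>\<bar>D\<bar>\<close> times
  nonnegative random variables. By Markov's inequality a nonnegative variable is at most of the order of
  its expectation in probability, so \<open>c1\<close> and \<open>c2\<close>, which only involve expectations, dispose of these
  sums. Since the score is bounded in probability and \<open>J / Js\<close> tends to \<open>1\<close>, the normalised error differs
  from \<open>- score\<close> by a term vanishing in probability; Slutsky's lemma and the symmetry of the normal law
  conclude.
\<close>

section \<open>Stochastic boundedness\<close>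

text \<open>This is the notion \<open>O_P(1)\<close>. On probability spaces each single variable is
  tight, so asking for the bound only for large \<open>n\<close> is equivalent to asking for it
  uniformly in \<open>n\<close>, and a limit statement delivers it directly.\<close>

definition bounded_in_probability ::
    "(nat \<Rightarrow> 'w measure) \<Rightarrow> (nat \<Rightarrow> 'w \<Rightarrow> real) \<Rightarrow> bool" where
  "bounded_in_probability P Y \<longleftrightarrow>
     (\<forall>n. Y n \<in> borel_measurable (P n)) \<and>
     (\<forall>\<kappa>>0. \<exists>K. \<forall>\<^sub>F n in sequentially. measure (P n) {\<omega> \<in> space (P n). K < \<bar>Y n \<omega>\<bar>} < \<kappa>)"

text \<open>Enlarging the threshold to \<open>max K 1\<close> only shrinks the event. Positivity of
  the bound is what permits dividing by it later.\<close>

lemma bounded_in_probability_obtain: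
  assumes "bounded_in_probability P Y" "0 < \<kappa>" "\<And>n. prob_space (P n)"
  obtains K :: real where "0 < K"
    "\<forall>\<^sub>F n in sequentially. measure (P n) {\<omega> \<in> space (P n). K < \<bar>Y n \<omega>\<bar>} < \<kappa>"
proof -
  have [measurable]: "\<And>n. Y n \<in> borel_measurable (P n)"
    using assms(1) by (simp add: bounded_in_probability_def)
  interpret prob_space "P n" for n by fact
  obtain K where K: "\<forall>\<^sub>F n in sequentially. measure (P n) {\<omega> \<in> space (P n). K < \<bar>Y n \<omega>\<bar>} < \<kappa>"
    using assms(1,2) unfolding bounded_in_probability_def by blast
  have "measure (P n) {\<omega> \<in> space (P n). max K 1 < \<bar>Y n \<omega>\<bar>}
      \<le> measure (P n) {\<omega> \<in> space (P n). K < \<bar>Y n \<omega>\<bar>}" for n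
    by (rule finite_measure_mono) auto
  then have "\<forall>\<^sub>F n in sequentially. measure (P n) {\<omega> \<in> space (P n). max K 1 < \<bar>Y n \<omega>\<bar>} < \<kappa>"
    by (intro eventually_mono[OF K]) (rule le_less_trans)
  then show ?thesis
    by (intro that[of "max K 1"]) auto
qed

lemma measure_tendsto_0I:
  assumes "\<And>\<kappa>. 0 < \<kappa> \<Longrightarrow> \<forall>\<^sub>F n in sequentially. measure (P n) (A n) < \<kappa>"
  shows "(\<lambda>n. measure (P n) (A n)) \<longlonglongrightarrow> 0"
proof (rule order_tendstoI)
  fix a :: real assume "a < 0"
  then show "\<forall>\<^sub>F n in sequentially. a < measure (P n) (A n)"
    by (intro always_eventually allI) (rule less_le_trans[OF _ measure_nonneg])
qed (rule assms)

section \<open>Calculus of convergence in probability\<close>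

locale prob_space_sequence =
  fixes P :: "nat \<Rightarrow> 'w measure"
  assumes prob_space_P: "\<And>n. prob_space (P n)"
begin

sublocale prob_space "P n" for n
  by (rule prob_space_P)

lemma tendsto_in_probability_measurable: "tendsto_in_probability P Y c \<Longrightarrow> Y n \<in> borel_measurable (P n)"
  by (simp add: tendsto_in_probability_def)

lemma tendsto_in_probability_tendsto_0:
  "tendsto_in_probability P Y c \<Longrightarrow> 0 < \<epsilon> \<Longrightarrow>
    (\<lambda>n. measure (P n) {\<omega> \<in> space (P n). \<epsilon> < \<bar>Y n \<omega> - c\<bar>}) \<longlonglongrightarrow> 0"
  by (simp add: tendsto_in_probability_def)

text \<open>Union bound: a large deviation of \<open>Z\<close> forces either a large
  \<open>W\<close> or the failure of \<open>G\<close>. The comparison may be confined to an event of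
  probability tending to 1, to large \<open>n\<close> and to almost every point; this is how the set
  where the estimator is undefined gets discarded.\<close>

lemma tendsto_in_probability_dominated:
  assumes Z[measurable]: "\<And>n. Z n \<in> borel_measurable (P n)"
    and W: "tendsto_in_probability P W 0"
    and G[measurable]: "\<And>n. Measurable.pred (P n) (G n)"
    and bad: "(\<lambda>n. measure (P n) {\<omega> \<in> space (P n). \<not> G n \<omega>}) \<longlonglongrightarrow> 0"
    and le: "\<forall>\<^sub>F n in sequentially. AE \<omega> in P n. G n \<omega> \<longrightarrow> \<bar>Z n \<omega> - c\<bar> \<le> \<bar>W n \<omega>\<bar>"
  shows "tendsto_in_probability P Z c"
  unfolding tendsto_in_probability_def
proof (intro conjI allI impI)
  fix \<epsilon> :: real assume \<epsilon>: "0 < \<epsilon>"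
  note [measurable] = tendsto_in_probability_measurable[OF W]
  show "(\<lambda>n. measure (P n) {\<omega> \<in> space (P n). \<epsilon> < \<bar>Z n \<omega> - c\<bar>}) \<longlonglongrightarrow> 0"
  proof (rule tendsto_sandwich[OF _ _ tendsto_const])
    show "(\<lambda>n. measure (P n) {\<omega> \<in> space (P n). \<epsilon> < \<bar>W n \<omega> - 0\<bar>}
        + measure (P n) {\<omega> \<in> space (P n). \<not> G n \<omega>}) \<longlonglongrightarrow> 0"
      using tendsto_add[OF tendsto_in_probability_tendsto_0[OF W \<epsilon>] bad] by simp
    show "\<forall>\<^sub>F n in sequentially. measure (P n) {\<omega> \<in> space (P n). \<epsilon> < \<bar>Z n \<omega> - c\<bar>}
        \<le> measure (P n) {\<omega> \<in> space (P n). \<epsilon> < \<bar>W n \<omega> - 0\<bar>}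
          + measure (P n) {\<omega> \<in> space (P n). \<not> G n \<omega>}"
      using le
    proof eventually_elim
      case (elim n)
      have "measure (P n) {\<omega> \<in> space (P n). \<epsilon> < \<bar>Z n \<omega> - c\<bar>}
          \<le> measure (P n) ({\<omega> \<in> space (P n). \<epsilon> < \<bar>W n \<omega> - 0\<bar>} \<union> {\<omega> \<in> space (P n). \<not> G n \<omega>})"
      proof (rule finite_measure_mono_AE)
        show "AE \<omega> in P n. \<omega> \<in> {\<omega> \<in> space (P n). \<epsilon> < \<bar>Z n \<omega> - c\<bar>} \<longrightarrow>
            \<omega> \<in> {\<omega> \<in> space (P n). \<epsilon> < \<bar>W n \<omega> - 0\<bar>} \<union> {\<omega> \<in> space (P n). \<not> G n \<omega>}"
          using elim by eventually_elim auto
      qed measurable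
      also have "\<dots> \<le> measure (P n) {\<omega> \<in> space (P n). \<epsilon> < \<bar>W n \<omega> - 0\<bar>}
          + measure (P n) {\<omega> \<in> space (P n). \<not> G n \<omega>}"
        by (rule measure_Un_le) auto
      finally show ?case .
    qed
  qed simp
qed simp

lemma tendsto_in_probability_dominated_AE:
  assumes "\<And>n. Z n \<in> borel_measurable (P n)" "tendsto_in_probability P W 0"
    and "\<forall>\<^sub>F n in sequentially. AE \<omega> in P n. \<bar>Z n \<omega> - c\<bar> \<le> \<bar>W n \<omega>\<bar>"
  shows "tendsto_in_probability P Z c"
  by (rule tendsto_in_probability_dominated[OF assms(1,2), where G = "\<lambda>_ _. True"]) (use assms(3) in simp_all)

lemma tendsto_in_probability_abs:
  assumes "tendsto_in_probability P Y 0"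
  shows "tendsto_in_probability P (\<lambda>n \<omega>. \<bar>Y n \<omega>\<bar>) 0"
  using assms by (simp add: tendsto_in_probability_def borel_measurable_abs)

lemma tendsto_in_probability_add:
  assumes Y: "tendsto_in_probability P Y 0" and W: "tendsto_in_probability P W 0"
  shows "tendsto_in_probability P (\<lambda>n \<omega>. Y n \<omega> + W n \<omega>) 0"
  unfolding tendsto_in_probability_def
proof (intro conjI allI impI)
  note [measurable] = tendsto_in_probability_measurable[OF Y] tendsto_in_probability_measurable[OF W]
  show "(\<lambda>\<omega>. Y n \<omega> + W n \<omega>) \<in> borel_measurable (P n)" for n by measurable
  fix \<epsilon> :: real assume "0 < \<epsilon>"
  then have \<epsilon>: "0 < \<epsilon> / 2" by simp
  show "(\<lambda>n. measure (P n) {\<omega> \<in> space (P n). \<epsilon> < \<bar>Y n \<omega> + W n \<omega> - 0\<bar>}) \<longlonglongrightarrow> 0"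
  proof (rule tendsto_sandwich[OF _ _ tendsto_const])
    show "(\<lambda>n. measure (P n) {\<omega> \<in> space (P n). \<epsilon> / 2 < \<bar>Y n \<omega> - 0\<bar>}
        + measure (P n) {\<omega> \<in> space (P n). \<epsilon> / 2 < \<bar>W n \<omega> - 0\<bar>}) \<longlonglongrightarrow> 0"
      using tendsto_add[OF tendsto_in_probability_tendsto_0[OF Y \<epsilon>] tendsto_in_probability_tendsto_0[OF W \<epsilon>]] by simp
    have "measure (P n) {\<omega> \<in> space (P n). \<epsilon> < \<bar>Y n \<omega> + W n \<omega> - 0\<bar>}
        \<le> measure (P n) ({\<omega> \<in> space (P n). \<epsilon> / 2 < \<bar>Y n \<omega> - 0\<bar>}
            \<union> {\<omega> \<in> space (P n). \<epsilon> / 2 < \<bar>W n \<omega> - 0\<bar>})" for n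
      by (rule finite_measure_mono) auto
    also have "\<dots> n \<le> measure (P n) {\<omega> \<in> space (P n). \<epsilon> / 2 < \<bar>Y n \<omega> - 0\<bar>}
        + measure (P n) {\<omega> \<in> space (P n). \<epsilon> / 2 < \<bar>W n \<omega> - 0\<bar>}" for n
      by (rule measure_Un_le) auto
    finally show "\<forall>\<^sub>F n in sequentially. measure (P n) {\<omega> \<in> space (P n). \<epsilon> < \<bar>Y n \<omega> + W n \<omega> - 0\<bar>}
        \<le> measure (P n) {\<omega> \<in> space (P n). \<epsilon> / 2 < \<bar>Y n \<omega> - 0\<bar>}
          + measure (P n) {\<omega> \<in> space (P n). \<epsilon> / 2 < \<bar>W n \<omega> - 0\<bar>}"
      by (rule always_eventually[OF allI])
  qed simp
qed

text \<open>The rule \<open>O_P(1) * o_P(1) = o_P(1)\<close>: if the product exceeds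
  \<open>\<epsilon>\<close>, then either \<open>B\<close> exceeds \<open>K\<close> or
  \<open>W\<close> exceeds \<open>\<epsilon> / K\<close>, and each event eventually has probability
  below \<open>\<kappa> / 2\<close>.\<close>

lemma tendsto_in_probability_mult_bounded:
  assumes W: "tendsto_in_probability P W 0" and B: "bounded_in_probability P B"
  shows "tendsto_in_probability P (\<lambda>n \<omega>. B n \<omega> * W n \<omega>) 0"
  unfolding tendsto_in_probability_def
proof (intro conjI allI impI)
  have [measurable]: "\<And>n. B n \<in> borel_measurable (P n)"
    using B by (simp add: bounded_in_probability_def)
  note [measurable] = tendsto_in_probability_measurable[OF W]
  show "(\<lambda>\<omega>. B n \<omega> * W n \<omega>) \<in> borel_measurable (P n)" for n by measurable
  fix \<epsilon> :: real assume \<epsilon>: "0 < \<epsilon>"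
  show "(\<lambda>n. measure (P n) {\<omega> \<in> space (P n). \<epsilon> < \<bar>B n \<omega> * W n \<omega> - 0\<bar>}) \<longlonglongrightarrow> 0"
  proof (rule measure_tendsto_0I)
    fix \<kappa> :: real assume \<kappa>: "0 < \<kappa>"
    obtain K where K: "0 < K"
      "\<forall>\<^sub>F n in sequentially. measure (P n) {\<omega> \<in> space (P n). K < \<bar>B n \<omega>\<bar>} < \<kappa> / 2"
      using bounded_in_probability_obtain[OF B _ prob_space_P, of "\<kappa> / 2"] \<kappa> by auto
    have "\<forall>\<^sub>F n in sequentially. measure (P n) {\<omega> \<in> space (P n). \<epsilon> / K < \<bar>W n \<omega> - 0\<bar>} < \<kappa> / 2"
      using \<epsilon> \<kappa> K(1) by (intro order_tendstoD(2)[OF tendsto_in_probability_tendsto_0[OF W]]) auto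
    with K(2) show "\<forall>\<^sub>F n in sequentially.
        measure (P n) {\<omega> \<in> space (P n). \<epsilon> < \<bar>B n \<omega> * W n \<omega> - 0\<bar>} < \<kappa>"
    proof eventually_elim
      case (elim n)
      have "{\<omega> \<in> space (P n). \<epsilon> < \<bar>B n \<omega> * W n \<omega> - 0\<bar>}
          \<subseteq> {\<omega> \<in> space (P n). K < \<bar>B n \<omega>\<bar>} \<union> {\<omega> \<in> space (P n). \<epsilon> / K < \<bar>W n \<omega> - 0\<bar>}"
      proof (rule subsetI, rule ccontr)
        fix \<omega> assume \<omega>: "\<omega> \<in> {\<omega> \<in> space (P n). \<epsilon> < \<bar>B n \<omega> * W n \<omega> - 0\<bar>}"
          "\<omega> \<notin> {\<omega> \<in> space (P n). K < \<bar>B n \<omega>\<bar>} \<union> {\<omega> \<in> space (P n). \<epsilon> / K < \<bar>W n \<omega> - 0\<bar>}"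
        then have "\<bar>B n \<omega>\<bar> * \<bar>W n \<omega>\<bar> \<le> K * (\<epsilon> / K)"
          using K(1) by (intro mult_mono) auto
        with \<omega>(1) K(1) show False by (simp add: abs_mult)
      qed
      then have "measure (P n) {\<omega> \<in> space (P n). \<epsilon> < \<bar>B n \<omega> * W n \<omega> - 0\<bar>}
          \<le> measure (P n) ({\<omega> \<in> space (P n). K < \<bar>B n \<omega>\<bar>}
              \<union> {\<omega> \<in> space (P n). \<epsilon> / K < \<bar>W n \<omega> - 0\<bar>})"
        by (rule finite_measure_mono) auto
      also have "\<dots> \<le> measure (P n) {\<omega> \<in> space (P n). K < \<bar>B n \<omega>\<bar>}
          + measure (P n) {\<omega> \<in> space (P n). \<epsilon> / K < \<bar>W n \<omega> - 0\<bar>}"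
        by (rule measure_Un_le) auto
      finally show ?case using elim by simp
    qed
  qed
qed

text \<open>By the triangle inequality, exceeding \<open>\<bar>c\<bar> + 1\<close> means being
  further than 1 from \<open>c\<close>.\<close>

lemma tendsto_in_probability_imp_bounded:
  assumes Y: "tendsto_in_probability P Y c"
  shows "bounded_in_probability P Y"
  unfolding bounded_in_probability_def
proof (intro conjI allI impI)
  note [measurable] = tendsto_in_probability_measurable[OF Y]
  fix \<kappa> :: real assume \<kappa>: "0 < \<kappa>"
  have "measure (P n) {\<omega> \<in> space (P n). \<bar>c\<bar> + 1 < \<bar>Y n \<omega>\<bar>}
      \<le> measure (P n) {\<omega> \<in> space (P n). 1 < \<bar>Y n \<omega> - c\<bar>}" for n
    by (rule finite_measure_mono) auto
  then show "\<exists>K. \<forall>\<^sub>F n in sequentially. measure (P n) {\<omega> \<in> space (P n). K < \<bar>Y n \<omega>\<bar>} < \<kappa>"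
    by (intro exI[of _ "\<bar>c\<bar> + 1"]
        eventually_mono[OF order_tendstoD(2)[OF tendsto_in_probability_tendsto_0[OF Y zero_less_one] \<kappa>]])
       (rule le_less_trans)
qed (rule tendsto_in_probability_measurable[OF Y])

text \<open>Continuous mapping for a constant limit. Continuity is required at \<open>c\<close>
  alone, so that inversion near 1 is covered although it is discontinuous at 0.\<close>

lemma tendsto_in_probability_compose:
  assumes Y: "tendsto_in_probability P Y c" and f: "isCont f c"
    and [measurable]: "f \<in> borel_measurable borel"
  shows "tendsto_in_probability P (\<lambda>n \<omega>. f (Y n \<omega>)) (f c)"
  unfolding tendsto_in_probability_def
proof (intro conjI allI impI)
  note [measurable] = tendsto_in_probability_measurable[OF Y]
  show "(\<lambda>\<omega>. f (Y n \<omega>)) \<in> borel_measurable (P n)" for n by measurable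
  fix \<epsilon> :: real assume "0 < \<epsilon>"
  then obtain d where d: "0 < d" "\<And>y. \<bar>y - c\<bar> < d \<Longrightarrow> \<bar>f y - f c\<bar> < \<epsilon>"
    using f unfolding continuous_at_eps_delta dist_real_def by metis
  \<comment> \<open>Off the deviation event only a non-strict bound on the distance is known, so
    halving \<open>d\<close> restores the strict bound that continuity asks for.\<close>
  then have d2: "0 < d / 2" by simp
  have le: "measure (P n) {\<omega> \<in> space (P n). \<epsilon> < \<bar>f (Y n \<omega>) - f c\<bar>}
      \<le> measure (P n) {\<omega> \<in> space (P n). d / 2 < \<bar>Y n \<omega> - c\<bar>}" for n
    using d(1) by (intro finite_measure_mono) (auto dest: d(2), smt (verit) d(2) field_sum_of_halves)
  show "(\<lambda>n. measure (P n) {\<omega> \<in> space (P n). \<epsilon> < \<bar>f (Y n \<omega>) - f c\<bar>}) \<longlonglongrightarrow> 0"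
    by (rule tendsto_sandwich[OF _ _ tendsto_const tendsto_in_probability_tendsto_0[OF Y d2]])
      (intro always_eventually allI le measure_nonneg)+
qed

text \<open>This lets the hypotheses on expectations control the random sums. Dividing
  \<open>U\<close> by its expectation gives a nonnegative variable of mean at most 1, which is
  bounded in probability by Markov's inequality; the expectation itself is moved to the factor
  \<open>W\<close>.\<close>

lemma tendsto_in_probability_mult_of_expectation:
  assumes U: "\<And>n. integrable (P n) (U n)" "\<And>n. AE \<omega> in P n. 0 \<le> U n \<omega>"
    and W[measurable]: "\<And>n. W n \<in> borel_measurable (P n)"
    and lim: "tendsto_in_probability P (\<lambda>n \<omega>. (LINT \<omega>'|P n. U n \<omega>') * W n \<omega>) 0"
  shows "tendsto_in_probability P (\<lambda>n \<omega>. U n \<omega> * W n \<omega>) 0"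
proof -
  note [measurable] = borel_measurable_integrable[OF U(1)]
  \<comment> \<open>\<open>V = 0\<close> where the expectation vanishes, but there \<open>U = 0\<close> almost surely.\<close>
  define V where "V n \<omega> = U n \<omega> / (LINT \<omega>'|P n. U n \<omega>')" for n \<omega>
  have [measurable]: "V n \<in> borel_measurable (P n)" for n
    unfolding V_def by measurable
  have E_nonneg: "0 \<le> (LINT \<omega>'|P n. U n \<omega>')" for n
    by (rule integral_nonneg_AE) (rule U)
  have V_le: "(LINT \<omega>|P n. V n \<omega>) \<le> 1" for n
    unfolding V_def by simp
  have V_nonneg: "AE \<omega> in P n. 0 \<le> V n \<omega>" for n
    using U(2)[of n] unfolding V_def
    by eventually_elim (use E_nonneg in simp)
  have "bounded_in_probability P V"
    unfolding bounded_in_probability_def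
  proof (intro conjI allI impI)
    fix \<kappa> :: real assume \<kappa>: "0 < \<kappa>"
    \<comment> \<open>With the threshold \<open>2 / \<kappa>\<close> Markov's inequality yields
      \<open>\<kappa> / 2\<close>, strictly below \<open>\<kappa>\<close>.\<close>
    have "measure (P n) {\<omega> \<in> space (P n). 2 / \<kappa> < \<bar>V n \<omega>\<bar>} < \<kappa>" for n
    proof -
      have "measure (P n) {\<omega> \<in> space (P n). 2 / \<kappa> < \<bar>V n \<omega>\<bar>}
          \<le> measure (P n) {\<omega> \<in> space (P n). 2 / \<kappa> \<le> V n \<omega>}"
      proof (rule finite_measure_mono_AE)
        show "AE \<omega> in P n. \<omega> \<in> {\<omega> \<in> space (P n). 2 / \<kappa> < \<bar>V n \<omega>\<bar>} \<longrightarrow>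
            \<omega> \<in> {\<omega> \<in> space (P n). 2 / \<kappa> \<le> V n \<omega>}"
          using V_nonneg[of n] by eventually_elim auto
      qed measurable
      also have "\<dots> \<le> (LINT \<omega>|P n. V n \<omega>) / (2 / \<kappa>)"
        using V_nonneg U(1) \<kappa> unfolding V_def
        by (intro integral_Markov_inequality_measure[where A = "{}"]) auto
      also have "\<dots> \<le> 1 / (2 / \<kappa>)"
        using \<kappa> by (intro divide_right_mono V_le) auto
      also have "\<dots> < \<kappa>" using \<kappa> by simp
      finally show ?thesis .
    qed
    then show "\<exists>K. \<forall>\<^sub>F n in sequentially. measure (P n) {\<omega> \<in> space (P n). K < \<bar>V n \<omega>\<bar>} < \<kappa>"
      by (intro exI[of _ "2 / \<kappa>"] always_eventually allI)
  qed measurable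
  from tendsto_in_probability_mult_bounded[OF lim this] show ?thesis
  proof (rule tendsto_in_probability_dominated_AE[rotated])
    have "AE \<omega> in P n. U n \<omega> = V n \<omega> * (LINT \<omega>'|P n. U n \<omega>')" for n
    proof (cases "(LINT \<omega>'|P n. U n \<omega>') = 0")
      case True
      then show ?thesis
        using integral_nonneg_eq_0_iff_AE[OF U, of n] by auto
    qed (simp add: V_def)
    then have "AE \<omega> in P n. \<bar>U n \<omega> * W n \<omega> - 0\<bar>
        \<le> \<bar>V n \<omega> * ((LINT \<omega>'|P n. U n \<omega>') * W n \<omega>)\<bar>" for n
      by eventually_elim (simp add: mult.assoc)
    then show "\<forall>\<^sub>F n in sequentially. AE \<omega> in P n. \<bar>U n \<omega> * W n \<omega> - 0\<bar>
        \<le> \<bar>V n \<omega> * ((LINT \<omega>'|P n. U n \<omega>') * W n \<omega>)\<bar>"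
      by (rule always_eventually[OF allI])
  qed measurable
qed

section \<open>Weak convergence: tightness, Slutsky's lemma and reflection of the normal law\<close>

lemma weak_conv_imp_bounded_in_probability:
  assumes [measurable]: "\<And>n. Y n \<in> borel_measurable (P n)"
    and \<mu>: "real_distribution \<mu>"
    and conv: "weak_conv_m (\<lambda>n. distr (P n) borel (Y n)) \<mu>"
  shows "bounded_in_probability P Y"
  unfolding bounded_in_probability_def
proof (intro conjI allI impI)
  interpret \<mu>: real_distribution \<mu> by fact
  fix \<kappa> :: real assume \<kappa>: "0 < \<kappa>"
  \<comment> \<open>Each of the two tails receives \<open>\<kappa> / 3\<close>, so that their sum
    stays below \<open>\<kappa>\<close>.\<close>
  have "\<forall>\<^sub>F x in at_top. 1 - \<kappa> / 3 < cdf \<mu> x"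
    using \<kappa> by (intro order_tendstoD(1)[OF \<mu>.cdf_lim_at_top_prob]) auto
  then obtain a where a: "\<And>x. a \<le> x \<Longrightarrow> 1 - \<kappa> / 3 < cdf \<mu> x"
    unfolding eventually_at_top_linorder by auto
  have "\<forall>\<^sub>F x in at_bot. cdf \<mu> x < \<kappa> / 3"
    using \<kappa> by (intro order_tendstoD(2)[OF \<mu>.cdf_lim_at_bot]) auto
  then obtain b where b: "\<And>x. x \<le> b \<Longrightarrow> cdf \<mu> x < \<kappa> / 3"
    unfolding eventually_at_bot_linorder by auto
  let ?A = "{x. measure \<mu> {x} \<noteq> 0}"
  \<comment> \<open>Weak convergence controls the distribution functions only at continuity points
    of the limit. The atoms and their reflections are countable, so some \<open>K\<close> in the
    interval makes both \<open>K\<close> and \<open>- K\<close> continuity points.\<close>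
  have "uncountable ({max a (-b)<..<max a (-b) + 1} - (?A \<union> uminus ` ?A))"
    using \<mu>.countable_support by (intro uncountable_minus_countable uncountable_open_interval[THEN iffD2]) auto
  then obtain K where "K \<in> {max a (-b)<..<max a (-b) + 1} - (?A \<union> uminus ` ?A)"
    by (metis countable_empty equals0I)
  then have K: "a \<le> K" "- K \<le> b" "isCont (cdf \<mu>) K" "isCont (cdf \<mu>) (- K)"
    unfolding \<mu>.isCont_cdf by (auto simp: image_iff)
  have lim: "(\<lambda>n. cdf (distr (P n) borel (Y n)) x) \<longlonglongrightarrow> cdf \<mu> x" if "isCont (cdf \<mu>) x" for x
    using conv that unfolding weak_conv_m_def weak_conv_def by blast
  have "\<forall>\<^sub>F n in sequentially. 1 - \<kappa> / 3 < cdf (distr (P n) borel (Y n)) K"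
    by (rule order_tendstoD(1)[OF lim[OF K(3)] a[OF K(1)]])
  moreover have "\<forall>\<^sub>F n in sequentially. cdf (distr (P n) borel (Y n)) (- K) < \<kappa> / 3"
    by (rule order_tendstoD(2)[OF lim[OF K(4)] b[OF K(2)]])
  ultimately have "\<forall>\<^sub>F n in sequentially. measure (P n) {\<omega> \<in> space (P n). K < \<bar>Y n \<omega>\<bar>} < \<kappa>"
  proof eventually_elim
    case (elim n)
    have cdf: "cdf (distr (P n) borel (Y n)) x = measure (P n) {\<omega> \<in> space (P n). Y n \<omega> \<le> x}" for x
      unfolding cdf_def by (subst measure_distr) (auto intro!: arg_cong[where f = "measure (P n)"])
    have "measure (P n) {\<omega> \<in> space (P n). K < \<bar>Y n \<omega>\<bar>}
        \<le> measure (P n) ({\<omega> \<in> space (P n). Y n \<omega> \<le> - K} \<union> {\<omega> \<in> space (P n). \<not> Y n \<omega> \<le> K})"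
      by (rule finite_measure_mono) auto
    also have "\<dots> \<le> measure (P n) {\<omega> \<in> space (P n). Y n \<omega> \<le> - K}
        + measure (P n) {\<omega> \<in> space (P n). \<not> Y n \<omega> \<le> K}"
      by (rule measure_Un_le) auto
    also have "measure (P n) {\<omega> \<in> space (P n). \<not> Y n \<omega> \<le> K}
        = 1 - measure (P n) {\<omega> \<in> space (P n). Y n \<omega> \<le> K}"
      by (rule prob_neg) auto
    finally show ?case using elim \<kappa> unfolding cdf by simp
  qed
  then show "\<exists>K. \<forall>\<^sub>F n in sequentially. measure (P n) {\<omega> \<in> space (P n). K < \<bar>Y n \<omega>\<bar>} < \<kappa>"
    by blast
qed measurable

text \<open>Where \<open>Z\<close> and \<open>Y\<close> are within \<open>\<epsilon>\<close>, the
  exponentials differ by at most \<open>\<bar>t\<bar> * \<epsilon>\<close>, since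
  \<open>iexp\<close> is 1-Lipschitz; elsewhere they differ by at most 2. Integrating this pointwise
  bound gives the estimate.\<close>

lemma norm_char_diff_le:
  assumes [measurable]: "Y \<in> borel_measurable (P n)" "Z \<in> borel_measurable (P n)" and \<epsilon>: "0 < \<epsilon>"
  shows "norm (char (distr (P n) borel Z) t - char (distr (P n) borel Y) t)
    \<le> \<bar>t\<bar> * \<epsilon> + 2 * measure (P n) {\<omega> \<in> space (P n). \<epsilon> < \<bar>Z \<omega> - Y \<omega>\<bar>}"
proof -
  let ?A = "{\<omega> \<in> space (P n). \<epsilon> < \<bar>Z \<omega> - Y \<omega>\<bar>}"
  have int: "integrable (P n) (\<lambda>\<omega>. iexp (t * Z \<omega>))" "integrable (P n) (\<lambda>\<omega>. iexp (t * Y \<omega>))"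
    by (auto intro!: integrable_const_bound[where B = 1])
  have "norm (char (distr (P n) borel Z) t - char (distr (P n) borel Y) t)
      = norm (LINT \<omega>|P n. iexp (t * Z \<omega>) - iexp (t * Y \<omega>))"
    using int by (simp add: char_def integral_distr)
  also have "\<dots> \<le> (LINT \<omega>|P n. norm (iexp (t * Z \<omega>) - iexp (t * Y \<omega>)))"
    by (rule integral_norm_bound)
  also have "\<dots> \<le> (LINT \<omega>|P n. \<bar>t\<bar> * \<epsilon> + 2 * indicator ?A \<omega>)"
  proof (rule integral_mono)
    show "integrable (P n) (\<lambda>\<omega>. norm (iexp (t * Z \<omega>) - iexp (t * Y \<omega>)))"
      using int by (intro integrable_norm Bochner_Integration.integrable_diff)
    show "integrable (P n) (\<lambda>\<omega>. \<bar>t\<bar> * \<epsilon> + 2 * indicator ?A \<omega>)"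
      by (intro Bochner_Integration.integrable_add integrable_mult_right) (auto simp: emeasure_eq_measure)
    fix \<omega> assume \<omega>: "\<omega> \<in> space (P n)"
    show "norm (iexp (t * Z \<omega>) - iexp (t * Y \<omega>)) \<le> \<bar>t\<bar> * \<epsilon> + 2 * indicator ?A \<omega>"
    proof (cases "\<omega> \<in> ?A")
      case True
      have "norm (iexp (t * Z \<omega>) - iexp (t * Y \<omega>)) \<le> 1 + 1"
        by (rule order_trans[OF norm_triangle_ineq4]) simp
      moreover have "0 \<le> \<bar>t\<bar> * \<epsilon>" using \<epsilon> by simp
      ultimately show ?thesis using True by simp
    next
      case False
      \<comment> \<open>The factor pulled out has modulus 1, which leaves a first-order estimate of
        \<open>iexp\<close> near 0.\<close>
      have "iexp (t * Z \<omega>) - iexp (t * Y \<omega>) = iexp (t * Y \<omega>) * (iexp (t * (Z \<omega> - Y \<omega>)) - 1)"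
        by (simp add: algebra_simps flip: exp_add)
      then have "norm (iexp (t * Z \<omega>) - iexp (t * Y \<omega>)) = norm (iexp (t * (Z \<omega> - Y \<omega>)) - 1)"
        by (simp add: norm_mult)
      also have "\<dots> \<le> \<bar>t * (Z \<omega> - Y \<omega>)\<bar>"
        using iexp_approx1[of "t * (Z \<omega> - Y \<omega>)" 0] by simp
      also have "\<dots> \<le> \<bar>t\<bar> * \<epsilon>"
        unfolding abs_mult using False \<omega> by (intro mult_left_mono) auto
      finally show ?thesis unfolding indicator_simps(2)[OF False] by simp
    qed
  qed
  also have "\<dots> = \<bar>t\<bar> * \<epsilon> + 2 * measure (P n) ?A"
    by (subst Bochner_Integration.integral_add) (auto simp: emeasure_eq_measure prob_space)
  finally show ?thesis .
qed

text \<open>By Levy's continuity theorem it suffices that the characteristic functions of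
  \<open>Z\<close> and \<open>Y\<close> approach each other at every \<open>t\<close>.\<close>

lemma slutsky_add:
  assumes Y[measurable]: "\<And>n. Y n \<in> borel_measurable (P n)"
    and Z[measurable]: "\<And>n. Z n \<in> borel_measurable (P n)"
    and \<mu>: "real_distribution \<mu>"
    and conv: "weak_conv_m (\<lambda>n. distr (P n) borel (Y n)) \<mu>"
    and diff: "tendsto_in_probability P (\<lambda>n \<omega>. Z n \<omega> - Y n \<omega>) 0"
  shows "weak_conv_m (\<lambda>n. distr (P n) borel (Z n)) \<mu>"
proof (rule levy_continuity)
  fix t
  have Yt: "(\<lambda>n. char (distr (P n) borel (Y n)) t) \<longlonglongrightarrow> char \<mu> t"
    by (rule levy_continuity1[OF _ \<mu> conv]) simp
  have "(\<lambda>n. char (distr (P n) borel (Z n)) t - char (distr (P n) borel (Y n)) t) \<longlonglongrightarrow> 0"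
  proof (rule tendstoI)
    fix e :: real assume e: "0 < e"
    \<comment> \<open>Adding 1 to \<open>\<bar>t\<bar>\<close> keeps the denominator positive at
      \<open>t = 0\<close>. This choice spends \<open>e / 2\<close> on the Lipschitz part; twice a
      probability below \<open>e / 4\<close> accounts for the rest.\<close>
    define \<epsilon> where "\<epsilon> = e / (2 * (\<bar>t\<bar> + 1))"
    have \<epsilon>: "0 < \<epsilon>" using e by (simp add: \<epsilon>_def)
    have "\<bar>t\<bar> * \<epsilon> \<le> (\<bar>t\<bar> + 1) * \<epsilon>" using \<epsilon> by (simp add: algebra_simps)
    also have "\<dots> = e / 2" by (simp add: \<epsilon>_def field_simps)
    finally have t\<epsilon>: "\<bar>t\<bar> * \<epsilon> \<le> e / 2" .
    have "\<forall>\<^sub>F n in sequentially. measure (P n) {\<omega> \<in> space (P n). \<epsilon> < \<bar>Z n \<omega> - Y n \<omega> - 0\<bar>} < e / 4"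
      using e by (intro order_tendstoD(2)[OF tendsto_in_probability_tendsto_0[OF diff \<epsilon>]]) auto
    then show "\<forall>\<^sub>F n in sequentially.
        dist (char (distr (P n) borel (Z n)) t - char (distr (P n) borel (Y n)) t) 0 < e"
    proof eventually_elim
      case (elim n)
      then show ?case
        using norm_char_diff_le[OF Y[of n] Z[of n] \<epsilon>, of t] t\<epsilon> by simp
    qed
  qed
  from tendsto_add[OF this Yt] show "(\<lambda>n. char (distr (P n) borel (Z n)) t) \<longlonglongrightarrow> char \<mu> t"
    by simp
qed (auto intro: \<mu>)

text \<open>Negating a variable reflects its characteristic function, and that of the standard
  normal law is even.\<close>

lemma weak_conv_std_normal_uminus:
  assumes Y[measurable]: "\<And>n. Y n \<in> borel_measurable (P n)"
    and conv: "weak_conv_m (\<lambda>n. distr (P n) borel (Y n)) std_normal_distribution"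
  shows "weak_conv_m (\<lambda>n. distr (P n) borel (\<lambda>\<omega>. - Y n \<omega>)) std_normal_distribution"
proof (rule levy_continuity)
  fix t
  have "char (distr (P n) borel (\<lambda>\<omega>. - Y n \<omega>)) t = char (distr (P n) borel (Y n)) (- t)" for n
    by (simp add: char_def integral_distr)
  moreover have "(\<lambda>n. char (distr (P n) borel (Y n)) (- t)) \<longlonglongrightarrow> char std_normal_distribution (- t)"
    by (rule levy_continuity1[OF _ real_dist_normal_dist conv]) simp
  ultimately show "(\<lambda>n. char (distr (P n) borel (\<lambda>\<omega>. - Y n \<omega>)) t) \<longlonglongrightarrow> char std_normal_distribution t"
    by (simp add: char_std_normal_distribution)
qed (auto intro: real_dist_normal_dist)

end

section \<open>Measurability of a random plug-in under the completion\<close>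

text \<open>Preimages under \<open>f\<close> and \<open>g\<close> differ only inside a null set, and
  the completion contains every subset of a null set.\<close>

lemma measurable_completion_AE:
  assumes g[measurable]: "g \<in> M \<rightarrow>\<^sub>M N" and ae: "AE x in M. f x = g x"
    and f: "\<And>x. x \<in> space M \<Longrightarrow> f x \<in> space N"
  shows "f \<in> completion M \<rightarrow>\<^sub>M N"
proof (rule measurableI)
  fix A assume A[measurable]: "A \<in> sets N"
  show "f -` A \<inter> space (completion M) \<in> sets (completion M)"
  proof (rule completion.in_sets_AE)
    show "g -` A \<inter> space M \<in> sets (completion M)"
      using measurable_sets[OF g A] by simp
    show "AE x in completion M. x \<in> g -` A \<inter> space M \<longleftrightarrow> x \<in> f -` A \<inter> space (completion M)"
      using AE_completion[OF ae] by eventually_elim simp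
  qed simp
qed (use f in simp)

text \<open>Off a null set \<open>N\<close> the plug-in is the pointwise limit of plug-ins at grid
  points approaching \<open>T\<close>. This gives measurability over \<open>M\<close> after cutting
  \<open>N\<close> out, and the completion absorbs \<open>N\<close>.\<close>

lemma measurable_plug_in_continuous:
  fixes G :: "real \<Rightarrow> 'w \<Rightarrow> real"
  assumes \<Theta>: "open \<Theta>" and T[measurable]: "T \<in> borel_measurable M"
    and G: "\<And>t. t \<in> \<Theta> \<Longrightarrow> G t \<in> borel_measurable M"
    and cont: "AE \<omega> in M. continuous_on \<Theta> (\<lambda>t. G t \<omega>)"
  shows "(\<lambda>\<omega>. if T \<omega> \<in> \<Theta> then G (T \<omega>) \<omega> else 0) \<in> borel_measurable (completion M)"
proof -
  obtain N where N: "N \<in> null_sets M" "\<And>\<omega>. \<omega> \<in> space M - N \<Longrightarrow> continuous_on \<Theta> (\<lambda>t. G t \<omega>)"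
    using cont by (auto elim!: AE_E3)
  have [measurable]: "N \<in> sets M" "\<Theta> \<in> sets borel" using N(1) \<Theta> by auto
  \<comment> \<open>\<open>a k\<close> takes countably many values, so \<open>G (a k (T \<omega>)) \<omega>\<close> is measurable without joint
    measurability of \<open>G\<close>.\<close>
  define a where "a k t = of_int \<lfloor>real (Suc k) * t\<rfloor> / real (Suc k)" for k t
  have a_lim: "(\<lambda>k. a k t) \<longlonglongrightarrow> t" for t
  proof (rule LIM_zero_cancel[OF LIMSEQ_norm_0])
    fix k
    have "a k t - t = - (frac (real (Suc k) * t)) / real (Suc k)"
      by (simp add: a_def frac_def field_simps)
    then show "norm (a k t - t) < 1 / real (Suc k)"
      using frac_lt_1[of "real (Suc k) * t"] frac_ge_0[of "real (Suc k) * t"]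
      by (simp add: divide_strict_right_mono)
  qed
  let ?F = "\<lambda>\<omega>. if T \<omega> \<in> \<Theta> \<and> \<omega> \<notin> N then G (T \<omega>) \<omega> else 0"
  let ?Fk = "\<lambda>k \<omega>. if T \<omega> \<in> \<Theta> \<and> \<omega> \<notin> N then (if a k (T \<omega>) \<in> \<Theta> then G (a k (T \<omega>)) \<omega> else 0) else 0"
  have "?F \<in> borel_measurable M"
  proof (rule borel_measurable_LIMSEQ_real)
    fix k
    let ?g = "\<lambda>i::int. \<lambda>\<omega>. if of_int i / real (Suc k) \<in> \<Theta> then G (of_int i / real (Suc k)) \<omega> else 0"
    have "?g i \<in> borel_measurable M" for i
      using G by (cases "of_int i / real (Suc k) \<in> \<Theta>") auto
    then have [measurable]: "(\<lambda>\<omega>. ?g \<lfloor>real (Suc k) * T \<omega>\<rfloor> \<omega>) \<in> borel_measurable M"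
      by (rule measurable_compose_countable) measurable
    show "?Fk k \<in> borel_measurable M"
      unfolding a_def by measurable
  next
    fix \<omega> assume \<omega>: "\<omega> \<in> space M"
    show "(\<lambda>k. ?Fk k \<omega>) \<longlonglongrightarrow> ?F \<omega>"
    proof (cases "T \<omega> \<in> \<Theta> \<and> \<omega> \<notin> N")
      case True
      have "isCont (\<lambda>t. G t \<omega>) (T \<omega>)"
        using N(2)[of \<omega>] True \<omega> \<Theta> by (simp add: continuous_on_eq_continuous_at)
      then have "(\<lambda>k. G (a k (T \<omega>)) \<omega>) \<longlonglongrightarrow> G (T \<omega>) \<omega>"
        using a_lim by (rule isCont_tendsto_compose)
      \<comment> \<open>A grid point may fall outside \<open>\<Theta>\<close>, where
        \<open>?Fk\<close> is cut to 0; since \<open>\<Theta>\<close> is open this happens for only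
        finitely many \<open>k\<close>.\<close>
      moreover have "\<forall>\<^sub>F k in sequentially. G (a k (T \<omega>)) \<omega> = ?Fk k \<omega>"
        using topological_tendstoD[OF a_lim \<Theta>, of "T \<omega>"] True by (auto elim: eventually_mono)
      ultimately have "(\<lambda>k. ?Fk k \<omega>) \<longlonglongrightarrow> G (T \<omega>) \<omega>"
        by (rule Lim_transform_eventually)
      then show ?thesis
        by (simp only: True if_True simp_thms)
    next
      case False
      then show ?thesis
        by (simp only: if_False simp_thms tendsto_const)
    qed
  qed
  then show ?thesis
  proof (rule measurable_completion_AE)
    show "AE \<omega> in M. (if T \<omega> \<in> \<Theta> then G (T \<omega>) \<omega> else 0) = ?F \<omega>"
      using AE_not_in[OF N(1)] by eventually_elim simp
  qed simp
qed

section \<open>Deterministic expansion of the one-step estimator\<close>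

text \<open>The mean value theorem writes the increment with the derivative at an intermediate
  \<open>\<xi>\<close>. Convexity keeps \<open>\<xi>\<close> in \<open>S\<close>, and
  \<open>\<xi>\<close> is no further from \<open>\<theta>\<close> than \<open>t\<close> is, so the
  Hoelder bound at \<open>\<xi>\<close> is at most the one at \<open>t\<close>.\<close>

lemma taylor_remainder_holder:
  fixes f :: "real \<Rightarrow> real"
  assumes S: "convex S" "\<theta> \<in> S" "t \<in> S" and q: "0 < q"
    and der: "\<And>s. s \<in> S \<Longrightarrow> (f has_real_derivative deriv f s) (at s)"
    and holder: "\<And>s. s \<in> S \<Longrightarrow> \<bar>deriv f s - deriv f \<theta>\<bar> \<le> C * \<bar>s - \<theta>\<bar> powr q"
    and C: "0 \<le> C"
  shows "\<bar>f t - f \<theta> - (t - \<theta>) * deriv f \<theta>\<bar> \<le> C * \<bar>t - \<theta>\<bar> powr (1 + q)"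
proof -
  have "\<exists>\<xi>\<in>S. \<bar>\<xi> - \<theta>\<bar> \<le> \<bar>t - \<theta>\<bar> \<and> f t - f \<theta> = (t - \<theta>) * deriv f \<xi>"
  proof (cases t \<theta> rule: linorder_cases)
    case less
    have "{t..\<theta>} \<subseteq> S" using closed_segment_subset[OF S(2,3,1)] less by (auto simp: closed_segment_eq_real_ivl)
    with MVT2[OF less, of f "deriv f"] der obtain z where
      "t < z" "z < \<theta>" "f \<theta> - f t = (\<theta> - t) * deriv f z" by (auto simp: subset_eq)
    then show ?thesis using \<open>{t..\<theta>} \<subseteq> S\<close> by (intro bexI[of _ z]) (auto simp: algebra_simps)
  next
    case equal
    then show ?thesis using S by (intro bexI[of _ \<theta>]) auto
  next
    case greater
    have "{\<theta>..t} \<subseteq> S" using closed_segment_subset[OF S(2,3,1)] greater by (auto simp: closed_segment_eq_real_ivl)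
    with MVT2[OF greater, of f "deriv f"] der obtain z where
      "\<theta> < z" "z < t" "f t - f \<theta> = (t - \<theta>) * deriv f z" by (auto simp: subset_eq)
    then show ?thesis using \<open>{\<theta>..t} \<subseteq> S\<close> by (intro bexI[of _ z]) auto
  qed
  then obtain \<xi> where \<xi>: "\<xi> \<in> S" "\<bar>\<xi> - \<theta>\<bar> \<le> \<bar>t - \<theta>\<bar>" "f t - f \<theta> = (t - \<theta>) * deriv f \<xi>" by blast
  have "\<bar>f t - f \<theta> - (t - \<theta>) * deriv f \<theta>\<bar> = \<bar>t - \<theta>\<bar> * \<bar>deriv f \<xi> - deriv f \<theta>\<bar>"
    by (simp add: \<xi>(3) abs_mult right_diff_distrib flip: right_diff_distrib)
  also have "\<dots> \<le> \<bar>t - \<theta>\<bar> * (C * \<bar>\<xi> - \<theta>\<bar> powr q)"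
    by (intro mult_left_mono holder \<xi>) auto
  also have "\<dots> \<le> \<bar>t - \<theta>\<bar> * (C * \<bar>t - \<theta>\<bar> powr q)"
    using C q \<xi>(2) by (intro mult_left_mono powr_mono2) auto
  also have "\<dots> = C * \<bar>t - \<theta>\<bar> powr (1 + q)"
    by (simp add: powr_mult_base)
  finally show ?thesis .
qed

text \<open>A purely algebraic inequality for one outcome, with no probability in it. Its right-hand
  side is arranged so that each summand meets one of the stochastic hypotheses: the last three in
  the bracket are nonnegative sums to be replaced by their expectations, and the final product pairs
  a vanishing ratio error with the score.\<close>

lemma one_step_expansion:
  fixes t \<theta> j J s p q :: real
  assumes s: "0 < s" and j: "j \<noteq> 0"
    and h: "\<And>i. i \<in> A \<Longrightarrow> \<bar>ht i - h i\<bar> \<le> hb i * \<bar>t - \<theta>\<bar> powr p"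
    and m: "\<And>i. i \<in> A \<Longrightarrow> \<bar>mt i - m i - (t - \<theta>) * m' i\<bar> \<le> C i * \<bar>t - \<theta>\<bar> powr (1 + q)"
  shows "\<bar>J / s * (t - (\<Sum>i\<in>A. ht i * mt i) / j - \<theta>) + (\<Sum>i\<in>A. h i * m i) / s\<bar>
    \<le> \<bar>J / j\<bar> *
        (\<bar>(\<Sum>i\<in>A. (ht i - h i) * m i) / s\<bar> + \<bar>(t - \<theta>) * (j - J) / s\<bar>
          + \<bar>(t - \<theta>) * ((\<Sum>i\<in>A. h i * m' i) - J) / s\<bar>
          + (\<Sum>i\<in>A. hb i * \<bar>m' i\<bar>) * (\<bar>t - \<theta>\<bar> powr (1 + p) / s)
          + (\<Sum>i\<in>A. hb i * C i) * (\<bar>t - \<theta>\<bar> powr (1 + q) * \<bar>t - \<theta>\<bar> powr p / s)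
          + (\<Sum>i\<in>A. \<bar>h i\<bar> * C i) * (\<bar>t - \<theta>\<bar> powr (1 + q) / s))
      + \<bar>J / j - 1\<bar> * \<bar>(\<Sum>i\<in>A. h i * m i) / s\<bar>"
    (is "\<bar>?Z + ?S\<bar> \<le> \<bar>?B\<bar> * (\<bar>?D\<bar> + \<bar>?c3\<bar> + \<bar>?c4\<bar> + ?V1 + ?V2 + ?V3) + _")
proof -
  define D where "D = t - \<theta>"
  define R1 where "R1 = D * (\<Sum>i\<in>A. (ht i - h i) * m' i) / s"
  define r where "r i = mt i - m i - (t - \<theta>) * m' i" for i
  define R2 where "R2 = (\<Sum>i\<in>A. ht i * r i) / s"
  \<comment> \<open>Substitute \<open>mt i = m i + D * m' i + r i\<close> and, in the first two of
    the resulting terms, \<open>ht i = h i + (ht i - h i)\<close>.\<close>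
  have sum_eq: "(\<Sum>i\<in>A. ht i * mt i) = (\<Sum>i\<in>A. h i * m i) + (\<Sum>i\<in>A. (ht i - h i) * m i)
      + D * (\<Sum>i\<in>A. h i * m' i) + D * (\<Sum>i\<in>A. (ht i - h i) * m' i) + (\<Sum>i\<in>A. ht i * r i)"
    unfolding sum_distrib_left sum.distrib[symmetric]
    by (rule sum.cong) (auto simp: r_def D_def algebra_simps)
  \<comment> \<open>Putting the error over the denominator \<open>j\<close> leaves
    \<open>D * j\<close> minus the linear term. Inserting \<open>J\<close> between them turns this
    difference into \<open>?c3 - ?c4\<close>.\<close>
  have Z: "?Z = ?B * (- ?S - ?D + ?c3 - ?c4 - R1 - R2)"
    unfolding sum_eq R1_def R2_def using s j by (simp add: D_def field_simps)
  have R1: "\<bar>R1\<bar> \<le> ?V1"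
  proof -
    have "\<bar>\<Sum>i\<in>A. (ht i - h i) * m' i\<bar> \<le> (\<Sum>i\<in>A. hb i * \<bar>D\<bar> powr p * \<bar>m' i\<bar>)"
      using h by (intro order_trans[OF sum_abs] sum_mono) (auto simp: abs_mult D_def intro!: mult_right_mono)
    also have "\<dots> = \<bar>D\<bar> powr p * (\<Sum>i\<in>A. hb i * \<bar>m' i\<bar>)"
      by (simp add: sum_distrib_left mult_ac)
    finally have "\<bar>R1\<bar> \<le> \<bar>D\<bar> * (\<bar>D\<bar> powr p * (\<Sum>i\<in>A. hb i * \<bar>m' i\<bar>)) / s"
      unfolding R1_def using s by (simp add: abs_mult divide_right_mono mult_left_mono)
    also have "\<dots> = (\<bar>D\<bar> * \<bar>D\<bar> powr p) * (\<Sum>i\<in>A. hb i * \<bar>m' i\<bar>) / s" by simp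
    also have "\<bar>D\<bar> * \<bar>D\<bar> powr p = \<bar>D\<bar> powr (1 + p)" by (simp add: powr_mult_base)
    finally show ?thesis by (simp add: D_def mult_ac)
  qed
  have R2: "\<bar>R2\<bar> \<le> ?V2 + ?V3"
  proof -
    \<comment> \<open>Bounding \<open>ht i\<close> by \<open>\<bar>h i\<bar>\<close> plus its
      Hoelder increment is what produces the two separate sums \<open>?V2\<close> and
      \<open>?V3\<close>.\<close>
    have term_le: "\<bar>ht i * r i\<bar> \<le> (hb i * \<bar>D\<bar> powr p + \<bar>h i\<bar>) * (C i * \<bar>D\<bar> powr (1 + q))"
      if "i \<in> A" for i
      unfolding abs_mult using h[OF that] m[OF that]
      by (intro mult_mono) (auto simp: D_def r_def)
    have "\<bar>\<Sum>i\<in>A. ht i * r i\<bar> \<le> (\<Sum>i\<in>A. (hb i * \<bar>D\<bar> powr p + \<bar>h i\<bar>) * (C i * \<bar>D\<bar> powr (1 + q)))"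
      by (intro order_trans[OF sum_abs] sum_mono term_le)
    also have "\<dots> = (\<Sum>i\<in>A. hb i * C i) * (\<bar>D\<bar> powr (1 + q) * \<bar>D\<bar> powr p)
        + (\<Sum>i\<in>A. \<bar>h i\<bar> * C i) * \<bar>D\<bar> powr (1 + q)"
      unfolding sum_distrib_right sum.distrib[symmetric]
      by (rule sum.cong) (auto simp: algebra_simps)
    finally show ?thesis
      unfolding R2_def using s by (simp add: D_def abs_divide divide_right_mono flip: add_divide_distrib)
  qed
  \<comment> \<open>The score enters multiplied by \<open>?B\<close>, but has to be compared with
    the score itself; the mismatch \<open>(?B - 1) * ?S\<close> is split off.\<close>
  have rearrange: "b * (- z - d + u - v - x - y) + z = b * (- d + u - v - x - y) - (b - 1) * z"
    for b z d u v x y :: real by algebra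
  have bound: "\<bar>- d + u - v - x - y\<bar> \<le> \<bar>d\<bar> + \<bar>u\<bar> + \<bar>v\<bar> + a + b + c"
    if "\<bar>x\<bar> \<le> a" "\<bar>y\<bar> \<le> b + c" for a b c d u v x y :: real
    using that by linarith
  have "?Z + ?S = ?B * (- ?D + ?c3 - ?c4 - R1 - R2) - (?B - 1) * ?S"
    unfolding Z by (rule rearrange)
  also have "\<bar>\<dots>\<bar> \<le> \<bar>?B\<bar> * \<bar>- ?D + ?c3 - ?c4 - R1 - R2\<bar> + \<bar>?B - 1\<bar> * \<bar>?S\<bar>"
    unfolding abs_mult[symmetric] by (rule abs_triangle_ineq4)
  also have "\<dots> \<le> \<bar>?B\<bar> * (\<bar>?D\<bar> + \<bar>?c3\<bar> + \<bar>?c4\<bar> + ?V1 + ?V2 + ?V3) + \<bar>?B - 1\<bar> * \<bar>?S\<bar>"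
    by (intro add_right_mono mult_left_mono bound R1 R2 abs_ge_zero)
  finally show ?thesis .
qed

section \<open>Regularity of the given functions and measurability of statistics\<close>

lemma holder_imp_continuous_on:
  fixes f :: "real \<Rightarrow> real"
  assumes p: "0 < p"
    and holder: "\<And>x y. x \<in> S \<Longrightarrow> y \<in> S \<Longrightarrow> \<bar>f x - f y\<bar> \<le> C * \<bar>x - y\<bar> powr p"
  shows "continuous_on S f"
  unfolding continuous_on_def
proof
  fix x assume x: "x \<in> S"
  have "((\<lambda>y. f y - f x) \<longlongrightarrow> 0) (at x within S)"
  proof (rule Lim_null_comparison)
    show "\<forall>\<^sub>F y in at x within S. norm (f y - f x) \<le> C * \<bar>y - x\<bar> powr p"
      using holder[OF _ x] by (auto simp: eventually_at_filter)
    have "((\<lambda>y. \<bar>y - x\<bar>) \<longlongrightarrow> 0) (at x within S)"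
      by (rule tendsto_eq_intros refl | simp)+
    then have "((\<lambda>y. \<bar>y - x\<bar> powr p) \<longlongrightarrow> 0) (at x within S)"
      using p by (intro tendsto_zero_powrI[where b = p] tendsto_const) auto
    then show "((\<lambda>y. C * \<bar>y - x\<bar> powr p) \<longlongrightarrow> 0) (at x within S)"
      by (rule tendsto_mult_right_zero)
  qed
  then show "(f \<longlongrightarrow> f x) (at x within S)"
    by (rule LIM_zero_cancel)
qed

lemma C1_differentiable_on_imp_has_real_derivative:
  fixes f :: "real \<Rightarrow> real"
  assumes "f C1_differentiable_on S" "s \<in> S"
  shows "(f has_real_derivative deriv f s) (at s)"
proof -
  obtain D where "(f has_real_derivative D) (at s)"
    using assms unfolding C1_differentiable_on_def has_real_derivative_iff_has_vector_derivative
    by blast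
  then show ?thesis
    using DERIV_imp_deriv by blast
qed

lemma is_statistic_imp_measurable:
  assumes T: "is_statistic M S n X T" and X: "\<And>i. i \<in> {1..n} \<Longrightarrow> X i \<in> M \<rightarrow>\<^sub>M S"
  shows "T \<in> borel_measurable M"
proof -
  obtain g where g: "g \<in> borel_measurable (\<Pi>\<^sub>M i\<in>{1..n}. S)"
    "\<And>\<omega>. \<omega> \<in> space M \<Longrightarrow> T \<omega> = g (\<lambda>i\<in>{1..n}. X i \<omega>)"
    using T unfolding is_statistic_def by blast
  have "(\<lambda>\<omega>. \<lambda>i\<in>{1..n}. X i \<omega>) \<in> M \<rightarrow>\<^sub>M (\<Pi>\<^sub>M i\<in>{1..n}. S)"
    using X by (rule measurable_restrict)
  from measurable_compose[OF this g(1)] show ?thesis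
    by (subst measurable_cong[OF g(2)])
qed

section \<open>Asymptotic normality of the one-step estimator\<close>

theorem mainTheorem8:
  fixes P :: "nat \<Rightarrow> 'w measure" and S :: "nat \<Rightarrow> 'x measure"
    and X :: "nat \<Rightarrow> nat \<Rightarrow> 'w \<Rightarrow> 'x"
    and \<Theta> :: "real set" and \<theta> p q :: real
    and h :: "nat \<Rightarrow> nat \<Rightarrow> real \<Rightarrow> real" and hbar :: "nat \<Rightarrow> nat \<Rightarrow> real"
    and M :: "nat \<Rightarrow> nat \<Rightarrow> real \<Rightarrow> 'x \<Rightarrow> real" and Mbar' :: "nat \<Rightarrow> nat \<Rightarrow> 'x \<Rightarrow> real"
    and \<theta>s Js :: "nat \<Rightarrow> 'w \<Rightarrow> real" and I J :: "nat \<Rightarrow> real"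
  assumes prob: "\<And>n. prob_space (P n)"
    and indep: "\<And>n. prob_space.indep_vars (P n) (\<lambda>_. S n) (X n) {1..n}"
    and \<Theta>: "open \<Theta>" "\<theta> \<in> \<Theta>"
    and p: "0 < p" "p \<le> 1" and q: "0 < q" "q \<le> 1"
    and hbar_nonneg: "\<And>n i. i \<in> {1..n} \<Longrightarrow> 0 \<le> hbar n i"
    and h_hoelder: "\<And>n i t1 t2. i \<in> {1..n} \<Longrightarrow> t1 \<in> \<Theta> \<Longrightarrow> t2 \<in> \<Theta> \<Longrightarrow>
          \<bar>h n i t1 - h n i t2\<bar> \<le> hbar n i * \<bar>t1 - t2\<bar> powr p"
    and M_measurable: "\<And>n i t. i \<in> {1..n} \<Longrightarrow> t \<in> \<Theta> \<Longrightarrow> M n i t \<in> borel_measurable (S n)"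
    and M_C1: "\<And>n i. i \<in> {1..n} \<Longrightarrow>
          AE \<omega> in P n. (\<lambda>t. M n i t (X n i \<omega>)) C1_differentiable_on \<Theta>"
    and Mbar'_nonneg: "\<And>n i x. i \<in> {1..n} \<Longrightarrow> x \<in> space (S n) \<Longrightarrow> 0 \<le> Mbar' n i x"
    and M'_hoelder: "\<And>n i. i \<in> {1..n} \<Longrightarrow>
          AE \<omega> in P n. \<forall>t\<in>\<Theta>.
            \<bar>param_deriv (M n i) t (X n i \<omega>) - param_deriv (M n i) \<theta> (X n i \<omega>)\<bar>
              \<le> Mbar' n i (X n i \<omega>) * \<bar>t - \<theta>\<bar> powr q"
    and Mbar'_integrable: "\<And>n i. i \<in> {1..n} \<Longrightarrow> integrable (P n) (\<lambda>\<omega>. Mbar' n i (X n i \<omega>))"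
    and M_centered: "\<And>n i. i \<in> {1..n} \<Longrightarrow> (LINT \<omega>|P n. M n i \<theta> (X n i \<omega>)) = 0"
    and M_square_integrable: "\<And>n i. i \<in> {1..n} \<Longrightarrow>
          integrable (P n) (\<lambda>\<omega>. (M n i \<theta> (X n i \<omega>))\<^sup>2)"
    and M'_integrable: "\<And>n i. i \<in> {1..n} \<Longrightarrow>
          integrable (P n) (\<lambda>\<omega>. param_deriv (M n i) \<theta> (X n i \<omega>))"
    and I_eq: "\<And>n. I n = (\<Sum>i=1..n. (h n i \<theta>)\<^sup>2 * (LINT \<omega>|P n. (M n i \<theta> (X n i \<omega>))\<^sup>2))"
    and J_eq: "\<And>n. J n = (\<Sum>i=1..n. h n i \<theta> * (LINT \<omega>|P n. param_deriv (M n i) \<theta> (X n i \<omega>)))"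
    and IJ_nondegenerate: "\<forall>\<^sub>F n in sequentially. 0 < I n \<and> J n \<noteq> 0"
    and clt: "weak_conv_m
          (\<lambda>n. distr (P n) borel (\<lambda>\<omega>. (\<Sum>i=1..n. h n i \<theta> * M n i \<theta> (X n i \<omega>)) / sqrt (I n)))
          std_normal_distribution"
    and \<theta>s_statistic: "\<And>n. is_statistic (P n) (S n) n (X n) (\<theta>s n)"
    and \<theta>s_consistent: "tendsto_in_probability P \<theta>s \<theta>"
    and Js_statistic: "\<And>n. is_statistic (P n) (S n) n (X n) (Js n)"
    and Js_ratio: "tendsto_in_probability P (\<lambda>n \<omega>. Js n \<omega> / J n) 1"
    and c1: "tendsto_in_probability P
          (\<lambda>n \<omega>. \<bar>\<theta>s n \<omega> - \<theta>\<bar> powr (1 + p) *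
             (\<Sum>i=1..n. hbar n i * (LINT \<omega>'|P n. \<bar>param_deriv (M n i) \<theta> (X n i \<omega>')\<bar>)) / sqrt (I n)) 0"
    and c2: "tendsto_in_probability P
          (\<lambda>n \<omega>. \<bar>\<theta>s n \<omega> - \<theta>\<bar> powr (1 + q) *
             (\<Sum>i=1..n. (\<bar>\<theta>s n \<omega> - \<theta>\<bar> powr p * hbar n i + \<bar>h n i \<theta>\<bar>) *
                (LINT \<omega>'|P n. Mbar' n i (X n i \<omega>'))) / sqrt (I n)) 0"
    and c3: "tendsto_in_probability P
          (\<lambda>n \<omega>. (\<theta>s n \<omega> - \<theta>) * (Js n \<omega> - J n) / sqrt (I n)) 0"
    and c4: "tendsto_in_probability P
          (\<lambda>n \<omega>. (\<theta>s n \<omega> - \<theta>) *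
             ((\<Sum>i=1..n. h n i \<theta> * param_deriv (M n i) \<theta> (X n i \<omega>)) - J n) / sqrt (I n)) 0"
    and d: "tendsto_in_probability P
          (\<lambda>n \<omega>. if \<theta>s n \<omega> \<in> \<Theta>
             then (\<Sum>i=1..n. (h n i (\<theta>s n \<omega>) - h n i \<theta>) * M n i \<theta> (X n i \<omega>)) / sqrt (I n)
             else undefined) 0"
  shows "(\<lambda>n. measure (P n) {\<omega> \<in> space (P n). one_step_defined \<Theta> (\<theta>s n \<omega>) (Js n \<omega>)}) \<longlonglongrightarrow> 1
    \<and> weak_conv_m
        (\<lambda>n. distr (completion (P n)) borel
          (\<lambda>\<omega>. J n / sqrt (I n) *
             (one_step_estimate \<Theta> n (h n) (M n) (\<lambda>i. X n i \<omega>) (\<theta>s n \<omega>) (Js n \<omega>) - \<theta>)))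
        std_normal_distribution"
proof -
  interpret prob_space_sequence P
    by (rule prob_space_sequence.intro) (rule prob)
  have X[measurable]: "X n i \<in> P n \<rightarrow>\<^sub>M S n" if "i \<in> {1..n}" for n i
    using indep[of n] that unfolding prob_space.indep_vars_def[OF prob] by blast
  have \<theta>s[measurable]: "\<theta>s n \<in> borel_measurable (P n)" for n
    by (rule tendsto_in_probability_measurable[OF \<theta>s_consistent])
  have Js[measurable]: "Js n \<in> borel_measurable (P n)" for n
    by (rule is_statistic_imp_measurable[OF Js_statistic X])
  have \<Theta>_borel[measurable]: "\<Theta> \<in> sets borel"
    using \<Theta>(1) by simp
  have MX: "(\<lambda>\<omega>. M n i t (X n i \<omega>)) \<in> borel_measurable (P n)" if "i \<in> {1..n}" "t \<in> \<Theta>" for n i t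
    by (rule measurable_compose[OF X M_measurable]) (use that in auto)
  have I_nonneg: "0 \<le> I n" for n
    unfolding I_eq by (intro sum_nonneg mult_nonneg_nonneg integral_nonneg_AE) auto

  \<comment> \<open>The event on which the estimator is defined\<close>
  \<comment> \<open>\<open>\<Theta>\<close> is open but possibly not convex; the ball supplies the
    convex neighbourhood on which the Taylor estimate is applied.\<close>
  obtain \<delta> where \<delta>: "0 < \<delta>" "ball \<theta> \<delta> \<subseteq> \<Theta>"
    using \<Theta> by (metis openE)
  define good where "good n \<omega> \<longleftrightarrow> \<bar>\<theta>s n \<omega> - \<theta>\<bar> < \<delta> \<and> Js n \<omega> \<noteq> 0" for n \<omega>
  have [measurable]: "Measurable.pred (P n) (good n)" for n
    unfolding good_def by measurable
  have good_defined: "one_step_defined \<Theta> (\<theta>s n \<omega>) (Js n \<omega>)" if "good n \<omega>" for n \<omega>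
    using that \<delta>(2) by (auto simp: good_def one_step_defined_def subset_eq dist_real_def abs_minus_commute)
  have bad: "(\<lambda>n. measure (P n) {\<omega> \<in> space (P n). \<not> good n \<omega>}) \<longlonglongrightarrow> 0"
  proof (rule tendsto_sandwich[OF _ _ tendsto_const])
    have \<delta>2: "0 < \<delta> / 2" using \<delta> by simp
    have half: "0 < (1 / 2 :: real)" by simp
    note [measurable] = tendsto_in_probability_measurable[OF Js_ratio]
    show "(\<lambda>n. measure (P n) {\<omega> \<in> space (P n). \<delta> / 2 < \<bar>\<theta>s n \<omega> - \<theta>\<bar>}
        + measure (P n) {\<omega> \<in> space (P n). 1 / 2 < \<bar>Js n \<omega> / J n - 1\<bar>}) \<longlonglongrightarrow> 0"
      using tendsto_add[OF tendsto_in_probability_tendsto_0[OF \<theta>s_consistent \<delta>2] tendsto_in_probability_tendsto_0[OF Js_ratio half]] by simp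
    \<comment> \<open>If \<open>Js n \<omega> = 0\<close>, the ratio
      \<open>Js n \<omega> / J n\<close> is 0 whatever \<open>J n\<close> is, hence at distance 1
      from its limit.\<close>
    have "measure (P n) {\<omega> \<in> space (P n). \<not> good n \<omega>}
        \<le> measure (P n) ({\<omega> \<in> space (P n). \<delta> / 2 < \<bar>\<theta>s n \<omega> - \<theta>\<bar>}
            \<union> {\<omega> \<in> space (P n). 1 / 2 < \<bar>Js n \<omega> / J n - 1\<bar>})" for n
      by (rule finite_measure_mono) (use \<delta>(1) in \<open>auto simp: good_def\<close>)
    also have "\<dots> n \<le> measure (P n) {\<omega> \<in> space (P n). \<delta> / 2 < \<bar>\<theta>s n \<omega> - \<theta>\<bar>}
        + measure (P n) {\<omega> \<in> space (P n). 1 / 2 < \<bar>Js n \<omega> / J n - 1\<bar>}" for n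
      by (rule measure_Un_le) auto
    finally show "\<forall>\<^sub>F n in sequentially. measure (P n) {\<omega> \<in> space (P n). \<not> good n \<omega>}
        \<le> measure (P n) {\<omega> \<in> space (P n). \<delta> / 2 < \<bar>\<theta>s n \<omega> - \<theta>\<bar>}
          + measure (P n) {\<omega> \<in> space (P n). 1 / 2 < \<bar>Js n \<omega> / J n - 1\<bar>}"
      by (rule always_eventually[OF allI])
  qed simp

  have defined_lim:
    "(\<lambda>n. measure (P n) {\<omega> \<in> space (P n). one_step_defined \<Theta> (\<theta>s n \<omega>) (Js n \<omega>)}) \<longlonglongrightarrow> 1"
  proof (rule tendsto_sandwich[OF _ _ _ tendsto_const])
    show "(\<lambda>n. 1 - measure (P n) {\<omega> \<in> space (P n). \<not> good n \<omega>}) \<longlonglongrightarrow> 1"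
      using tendsto_diff[OF tendsto_const bad, of 1] by simp
    have "1 - measure (P n) {\<omega> \<in> space (P n). \<not> good n \<omega>}
        = measure (P n) {\<omega> \<in> space (P n). good n \<omega>}" for n
      by (subst prob_neg) auto
    also have "\<dots> n \<le> measure (P n) {\<omega> \<in> space (P n). one_step_defined \<Theta> (\<theta>s n \<omega>) (Js n \<omega>)}" for n
      by (rule finite_measure_mono) (use good_defined in \<open>auto simp: one_step_defined_def\<close>)
    finally show "\<forall>\<^sub>F n in sequentially. 1 - measure (P n) {\<omega> \<in> space (P n). \<not> good n \<omega>}
        \<le> measure (P n) {\<omega> \<in> space (P n). one_step_defined \<Theta> (\<theta>s n \<omega>) (Js n \<omega>)}"
      by (rule always_eventually[OF allI])
  qed simp

  \<comment> \<open>The score, and a measurable version of the normalised error\<close>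
  define score where "score = (\<lambda>n \<omega>. (\<Sum>i=1..n. h n i \<theta> * M n i \<theta> (X n i \<omega>)) / sqrt (I n))"
  have score[measurable]: "score n \<in> borel_measurable (P n)" for n
    unfolding score_def using MX[OF _ \<Theta>(2)] by measurable
  have clt': "weak_conv_m (\<lambda>n. distr (P n) borel (score n)) std_normal_distribution"
    using clt unfolding score_def .

  define Z0 where "Z0 = (\<lambda>n \<omega>. J n / sqrt (I n) *
    (one_step_estimate \<Theta> n (h n) (M n) (\<lambda>i. X n i \<omega>) (\<theta>s n \<omega>) (Js n \<omega>) - \<theta>))"
  have Z0_measurable: "Z0 n \<in> borel_measurable (completion (P n))" for n
  proof -
    let ?G = "\<lambda>t \<omega>. \<Sum>i=1..n. h n i t * M n i t (X n i \<omega>)"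
    have h_cont: "continuous_on \<Theta> (h n i)" if "i \<in> {1..n}" for i
      using p(1) h_hoelder[OF that] by (rule holder_imp_continuous_on)
    have "AE \<omega> in P n. \<forall>i\<in>{1..n}. (\<lambda>t. M n i t (X n i \<omega>)) C1_differentiable_on \<Theta>"
      by (rule AE_finite_allI) (use M_C1 in auto)
    then have cont: "AE \<omega> in P n. continuous_on \<Theta> (\<lambda>t. ?G t \<omega>)"
      by eventually_elim
        (intro continuous_on_sum continuous_on_mult h_cont,
         auto intro: C1_differentiable_imp_continuous_on)
    have F: "(\<lambda>\<omega>. if \<theta>s n \<omega> \<in> \<Theta> then ?G (\<theta>s n \<omega>) \<omega> else 0) \<in> borel_measurable (completion (P n))"
      by (rule measurable_plug_in_continuous[OF \<Theta>(1) \<theta>s _ cont])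
        (intro borel_measurable_sum borel_measurable_times borel_measurable_const MX)
    have [measurable]: "\<theta>s n \<in> borel_measurable (completion (P n))"
        "Js n \<in> borel_measurable (completion (P n))"
      by (intro measurable_completion \<theta>s Js)+
    \<comment> \<open>The inner guard is redundant under the outer one; it exposes exactly the
      function shown measurable in \<open>F\<close>.\<close>
    have "Z0 n = (\<lambda>\<omega>. J n / sqrt (I n) * ((if \<theta>s n \<omega> \<in> \<Theta> \<and> Js n \<omega> \<noteq> 0
        then \<theta>s n \<omega> - (if \<theta>s n \<omega> \<in> \<Theta> then ?G (\<theta>s n \<omega>) \<omega> else 0) / Js n \<omega> else undefined) - \<theta>))"
      by (intro ext) (simp add: Z0_def one_step_estimate_def one_step_defined_def)
    also have "\<dots> \<in> borel_measurable (completion (P n))"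
      using F by measurable
    finally show ?thesis .
  qed
  \<comment> \<open>Convergence in probability is formulated over \<open>P n\<close>, so
    \<open>Z0\<close> is exchanged for an almost surely equal \<open>Z\<close> measurable there; the
    law does not change.\<close>
  then have "\<exists>g. g \<in> borel_measurable (P n) \<and> (AE \<omega> in P n. Z0 n \<omega> = g \<omega>)" for n
    using completion_ex_borel_measurable_real by blast
  then obtain Z where Z[measurable]: "\<And>n. Z n \<in> borel_measurable (P n)"
    and Z_eq: "\<And>n. AE \<omega> in P n. Z0 n \<omega> = Z n \<omega>"
    by metis
  have distr_Z0: "distr (completion (P n)) borel (Z0 n) = distr (P n) borel (Z n)" for n
  proof -
    have "distr (completion (P n)) borel (Z0 n) = distr (completion (P n)) borel (Z n)"
      by (rule distr_cong_AE[OF refl refl AE_completion[OF Z_eq] Z0_measurable measurable_completion[OF Z]])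
    then show ?thesis
      by (simp add: distr_completion)
  qed

  \<comment> \<open>Remainder sums controlled through their expectations\<close>
  \<comment> \<open>The products \<open>U1 * W1\<close>, \<open>U2 * W2\<close> and
    \<open>U3 * W3\<close> are the last three terms in the bracket of
    \<open>one_step_expansion\<close>: \<open>U\<close> collects the data sums, \<open>W\<close> the
    powers of the preliminary error.\<close>
  define U1 where "U1 n \<omega> = (\<Sum>i=1..n. hbar n i * \<bar>param_deriv (M n i) \<theta> (X n i \<omega>)\<bar>)" for n \<omega>
  define U2 where "U2 n \<omega> = (\<Sum>i=1..n. hbar n i * Mbar' n i (X n i \<omega>))" for n \<omega>
  define U3 where "U3 n \<omega> = (\<Sum>i=1..n. \<bar>h n i \<theta>\<bar> * Mbar' n i (X n i \<omega>))" for n \<omega>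
  have Mbar'_AE: "AE \<omega> in P n. \<forall>i\<in>{1..n}. 0 \<le> Mbar' n i (X n i \<omega>)" for n
    using Mbar'_nonneg measurable_space[OF X] by (intro AE_I2) blast
  have U_integrable: "integrable (P n) (U1 n)" "integrable (P n) (U2 n)" "integrable (P n) (U3 n)" for n
    unfolding U1_def U2_def U3_def
    by (intro Bochner_Integration.integrable_sum integrable_mult_right integrable_abs
        M'_integrable Mbar'_integrable; assumption)+
  have U1_nonneg: "AE \<omega> in P n. 0 \<le> U1 n \<omega>" for n
    unfolding U1_def using hbar_nonneg by (intro AE_I2 sum_nonneg mult_nonneg_nonneg) auto
  have U2_nonneg: "AE \<omega> in P n. 0 \<le> U2 n \<omega>" for n
    using Mbar'_AE[of n] unfolding U2_def
    by eventually_elim (use hbar_nonneg in \<open>auto intro!: sum_nonneg mult_nonneg_nonneg\<close>)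
  have U3_nonneg: "AE \<omega> in P n. 0 \<le> U3 n \<omega>" for n
    using Mbar'_AE[of n] unfolding U3_def
    by eventually_elim (auto intro!: sum_nonneg mult_nonneg_nonneg)
  have EU1: "(LINT \<omega>|P n. U1 n \<omega>)
      = (\<Sum>i=1..n. hbar n i * (LINT \<omega>|P n. \<bar>param_deriv (M n i) \<theta> (X n i \<omega>)\<bar>))" for n
    unfolding U1_def
    by (subst Bochner_Integration.integral_sum) (auto intro!: integrable_mult_right integrable_abs M'_integrable)
  have EU2: "(LINT \<omega>|P n. U2 n \<omega>) = (\<Sum>i=1..n. hbar n i * (LINT \<omega>|P n. Mbar' n i (X n i \<omega>)))" for n
    unfolding U2_def
    by (subst Bochner_Integration.integral_sum) (auto intro!: integrable_mult_right Mbar'_integrable)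
  have EU3: "(LINT \<omega>|P n. U3 n \<omega>) = (\<Sum>i=1..n. \<bar>h n i \<theta>\<bar> * (LINT \<omega>|P n. Mbar' n i (X n i \<omega>)))" for n
    unfolding U3_def
    by (subst Bochner_Integration.integral_sum) (auto intro!: integrable_mult_right Mbar'_integrable)

  define W1 where "W1 n \<omega> = \<bar>\<theta>s n \<omega> - \<theta>\<bar> powr (1 + p) / sqrt (I n)" for n \<omega>
  define W2 where "W2 n \<omega> = \<bar>\<theta>s n \<omega> - \<theta>\<bar> powr (1 + q) * \<bar>\<theta>s n \<omega> - \<theta>\<bar> powr p / sqrt (I n)" for n \<omega>
  define W3 where "W3 n \<omega> = \<bar>\<theta>s n \<omega> - \<theta>\<bar> powr (1 + q) / sqrt (I n)" for n \<omega>
  have [measurable]: "W1 n \<in> borel_measurable (P n)" "W2 n \<in> borel_measurable (P n)"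
      "W3 n \<in> borel_measurable (P n)" for n
    unfolding W1_def W2_def W3_def by measurable
  have W_nonneg: "0 \<le> W2 n \<omega>" "0 \<le> W3 n \<omega>" for n \<omega>
    unfolding W2_def W3_def using I_nonneg[of n] by auto
  have V1: "tendsto_in_probability P (\<lambda>n \<omega>. U1 n \<omega> * W1 n \<omega>) 0"
  proof (rule tendsto_in_probability_mult_of_expectation[OF U_integrable(1) U1_nonneg])
    show "tendsto_in_probability P (\<lambda>n \<omega>. (LINT \<omega>'|P n. U1 n \<omega>') * W1 n \<omega>) 0"
      using c1 unfolding EU1 W1_def by (simp add: mult.commute)
  qed measurable
  \<comment> \<open>Hypothesis \<open>c2\<close> treats both sums together. Both parts are
    nonnegative, so each is dominated by the whole and vanishes separately.\<close>
  have c2_split: "\<bar>\<theta>s n \<omega> - \<theta>\<bar> powr (1 + q) *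
        (\<Sum>i=1..n. (\<bar>\<theta>s n \<omega> - \<theta>\<bar> powr p * hbar n i + \<bar>h n i \<theta>\<bar>) *
          (LINT \<omega>'|P n. Mbar' n i (X n i \<omega>'))) / sqrt (I n)
      = (LINT \<omega>'|P n. U2 n \<omega>') * W2 n \<omega> + (LINT \<omega>'|P n. U3 n \<omega>') * W3 n \<omega>" for n \<omega>
  proof -
    have "(\<Sum>i=1..n. (\<bar>\<theta>s n \<omega> - \<theta>\<bar> powr p * hbar n i + \<bar>h n i \<theta>\<bar>) *
          (LINT \<omega>'|P n. Mbar' n i (X n i \<omega>')))
        = \<bar>\<theta>s n \<omega> - \<theta>\<bar> powr p * (LINT \<omega>'|P n. U2 n \<omega>') + (LINT \<omega>'|P n. U3 n \<omega>')"
      unfolding EU2 EU3 sum_distrib_left sum.distrib[symmetric]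
      by (rule sum.cong) (simp_all add: algebra_simps)
    then show ?thesis
      unfolding W2_def W3_def by (simp add: algebra_simps add_divide_distrib)
  qed
  have parts_nonneg: "0 \<le> (LINT \<omega>'|P n. U2 n \<omega>') * W2 n \<omega>"
      "0 \<le> (LINT \<omega>'|P n. U3 n \<omega>') * W3 n \<omega>" for n \<omega>
    by (intro mult_nonneg_nonneg integral_nonneg_AE U2_nonneg U3_nonneg W_nonneg)+
  note c2' = c2[unfolded c2_split]
  have V2: "tendsto_in_probability P (\<lambda>n \<omega>. U2 n \<omega> * W2 n \<omega>) 0"
  proof (rule tendsto_in_probability_mult_of_expectation[OF U_integrable(2) U2_nonneg])
    show "tendsto_in_probability P (\<lambda>n \<omega>. (LINT \<omega>'|P n. U2 n \<omega>') * W2 n \<omega>) 0"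
      by (rule tendsto_in_probability_dominated_AE[OF _ c2']) (measurable, use parts_nonneg in simp)
  qed measurable
  have V3: "tendsto_in_probability P (\<lambda>n \<omega>. U3 n \<omega> * W3 n \<omega>) 0"
  proof (rule tendsto_in_probability_mult_of_expectation[OF U_integrable(3) U3_nonneg])
    show "tendsto_in_probability P (\<lambda>n \<omega>. (LINT \<omega>'|P n. U3 n \<omega>') * W3 n \<omega>) 0"
      by (rule tendsto_in_probability_dominated_AE[OF _ c2']) (measurable, use parts_nonneg in simp)
  qed measurable

  \<comment> \<open>The vanishing bound and the conclusion by Slutsky's lemma\<close>
  have ratio_bounded: "bounded_in_probability P (\<lambda>n \<omega>. \<bar>J n / Js n \<omega>\<bar>)"
    using tendsto_in_probability_imp_bounded[OF tendsto_in_probability_compose[OF Js_ratio, of "\<lambda>x. \<bar>inverse x\<bar>"]]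
    by (simp add: continuous_intros)
  have ratio_lim: "tendsto_in_probability P (\<lambda>n \<omega>. \<bar>J n / Js n \<omega> - 1\<bar>) 0"
    using tendsto_in_probability_compose[OF Js_ratio, of "\<lambda>x. \<bar>inverse x - 1\<bar>"]
    by (simp add: continuous_intros)
  have score_bounded: "bounded_in_probability P (\<lambda>n \<omega>. \<bar>score n \<omega>\<bar>)"
    using weak_conv_imp_bounded_in_probability[OF score real_dist_normal_dist clt']
    by (simp add: bounded_in_probability_def borel_measurable_abs)
  \<comment> \<open>The nesting follows the summation order in \<open>one_step_expansion\<close>, so
    that the limit statement matches that bound term by term.\<close>
  note terms = tendsto_in_probability_add[OF tendsto_in_probability_mult_bounded[OF
      tendsto_in_probability_add[OF tendsto_in_probability_add[OF tendsto_in_probability_add[OF tendsto_in_probability_add[OF tendsto_in_probability_add[OF tendsto_in_probability_abs[OF d] tendsto_in_probability_abs[OF c3]] tendsto_in_probability_abs[OF c4]]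
        V1] V2] V3] ratio_bounded]
      tendsto_in_probability_mult_bounded[OF ratio_lim score_bounded]]

  have "tendsto_in_probability P (\<lambda>n \<omega>. Z n \<omega> - (- score n \<omega>)) 0"
  \<comment> \<open>The comparison is made on the good event, where the \<open>undefined\<close>
    branches of the estimator and of \<open>d\<close> do not occur.\<close>
  proof (rule tendsto_in_probability_dominated[OF _ terms _ bad])
    show "\<forall>\<^sub>F n in sequentially. AE \<omega> in P n. good n \<omega> \<longrightarrow> \<bar>Z n \<omega> - - score n \<omega> - 0\<bar> \<le>
        \<bar>\<bar>J n / Js n \<omega>\<bar> *
          (\<bar>if \<theta>s n \<omega> \<in> \<Theta>
             then (\<Sum>i=1..n. (h n i (\<theta>s n \<omega>) - h n i \<theta>) * M n i \<theta> (X n i \<omega>)) / sqrt (I n)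
             else undefined\<bar> +
           \<bar>(\<theta>s n \<omega> - \<theta>) * (Js n \<omega> - J n) / sqrt (I n)\<bar> +
           \<bar>(\<theta>s n \<omega> - \<theta>) *
             ((\<Sum>i=1..n. h n i \<theta> * param_deriv (M n i) \<theta> (X n i \<omega>)) - J n) / sqrt (I n)\<bar> +
           U1 n \<omega> * W1 n \<omega> + U2 n \<omega> * W2 n \<omega> + U3 n \<omega> * W3 n \<omega>) +
         \<bar>score n \<omega>\<bar> * \<bar>J n / Js n \<omega> - 1\<bar>\<bar>"
      using IJ_nondegenerate
    proof eventually_elim
      case (elim n)
      have "AE \<omega> in P n. \<forall>i\<in>{1..n}. (\<lambda>t. M n i t (X n i \<omega>)) C1_differentiable_on \<Theta>"
        by (rule AE_finite_allI) (use M_C1 in auto)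
      moreover have "AE \<omega> in P n. \<forall>i\<in>{1..n}. \<forall>t\<in>\<Theta>.
          \<bar>param_deriv (M n i) t (X n i \<omega>) - param_deriv (M n i) \<theta> (X n i \<omega>)\<bar>
            \<le> Mbar' n i (X n i \<omega>) * \<bar>t - \<theta>\<bar> powr q"
        by (rule AE_finite_allI) (use M'_hoelder in auto)
      ultimately show ?case
        using Mbar'_AE[of n] Z_eq[of n]
      proof eventually_elim
        case ae: (elim \<omega>)
        show ?case
        proof
          assume good: "good n \<omega>"
          then have t: "\<theta>s n \<omega> \<in> ball \<theta> \<delta>" "\<theta>s n \<omega> \<in> \<Theta>" and j: "Js n \<omega> \<noteq> 0"
            using good_defined[OF good]
            by (auto simp: good_def one_step_defined_def dist_real_def abs_minus_commute)
          have Z: "Z n \<omega> = J n / sqrt (I n) *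
              (\<theta>s n \<omega> - (\<Sum>i=1..n. h n i (\<theta>s n \<omega>) * M n i (\<theta>s n \<omega>) (X n i \<omega>)) / Js n \<omega> - \<theta>)"
            using ae(4) good_defined[OF good] by (simp add: Z0_def one_step_estimate_def)
          have taylor: "\<bar>M n i (\<theta>s n \<omega>) (X n i \<omega>) - M n i \<theta> (X n i \<omega>)
                - (\<theta>s n \<omega> - \<theta>) * param_deriv (M n i) \<theta> (X n i \<omega>)\<bar>
              \<le> Mbar' n i (X n i \<omega>) * \<bar>\<theta>s n \<omega> - \<theta>\<bar> powr (1 + q)" if i: "i \<in> {1..n}" for i
          proof (rule taylor_remainder_holder[OF convex_ball _ t(1) q(1)])
            fix s assume "s \<in> ball \<theta> \<delta>"
            then have s: "s \<in> \<Theta>" using \<delta>(2) by blast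
            show "((\<lambda>s. M n i s (X n i \<omega>)) has_real_derivative param_deriv (M n i) s (X n i \<omega>)) (at s)"
              using ae(1) i s by (blast intro: C1_differentiable_on_imp_has_real_derivative)
            show "\<bar>param_deriv (M n i) s (X n i \<omega>) - param_deriv (M n i) \<theta> (X n i \<omega>)\<bar>
                \<le> Mbar' n i (X n i \<omega>) * \<bar>s - \<theta>\<bar> powr q"
              using ae(2) i s by blast
          qed (use \<delta>(1) ae(3) i in auto)
          have "0 < sqrt (I n)" using elim by simp
          from one_step_expansion[OF this j h_hoelder[OF _ t(2) \<Theta>(2)] taylor,
              where J = "J n" and A = "{1..n}"]
          show "\<bar>Z n \<omega> - - score n \<omega> - 0\<bar> \<le>
              \<bar>\<bar>J n / Js n \<omega>\<bar> *
                (\<bar>if \<theta>s n \<omega> \<in> \<Theta>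
                   then (\<Sum>i=1..n. (h n i (\<theta>s n \<omega>) - h n i \<theta>) * M n i \<theta> (X n i \<omega>)) / sqrt (I n)
                   else undefined\<bar> +
                 \<bar>(\<theta>s n \<omega> - \<theta>) * (Js n \<omega> - J n) / sqrt (I n)\<bar> +
                 \<bar>(\<theta>s n \<omega> - \<theta>) *
                   ((\<Sum>i=1..n. h n i \<theta> * param_deriv (M n i) \<theta> (X n i \<omega>)) - J n) / sqrt (I n)\<bar> +
                 U1 n \<omega> * W1 n \<omega> + U2 n \<omega> * W2 n \<omega> + U3 n \<omega> * W3 n \<omega>) +
               \<bar>score n \<omega>\<bar> * \<bar>J n / Js n \<omega> - 1\<bar>\<bar>"
            \<comment> \<open>The commutation puts the score factor where
              \<open>one_step_expansion\<close> has it; the outer absolute value demanded by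
              domination only increases the bound.\<close>
            unfolding Z if_P[OF t(2)] U1_def U2_def U3_def W1_def W2_def W3_def score_def
              diff_minus_eq_add diff_0_right mult.commute[of "\<bar>sum _ _ / _\<bar>"]
            by (auto intro: order_trans[OF _ abs_ge_self])
        qed
      qed
    qed
  qed measurable
  then have "weak_conv_m (\<lambda>n. distr (P n) borel (Z n)) std_normal_distribution"
    by (intro slutsky_add[OF _ Z real_dist_normal_dist weak_conv_std_normal_uminus[OF score clt']]) measurable
  then have "weak_conv_m (\<lambda>n. distr (completion (P n)) borel (Z0 n)) std_normal_distribution"
    unfolding distr_Z0 .
  with defined_lim show ?thesis
    unfolding Z0_def by blast
qed

end
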